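(* Let $r\ge 1$ and let $N\in\mathcal{M}_r$. Then $N$ can be obtained from $P_r$ by a finite sequence of the operations of complementation and switching if and only if $N$ is isomorphic to one of $P_r$, $U_{0,0}$, $P_{r-1}$, and $A_r$.
   Context: $P_r=PG(r-1,2)$ is the rank-$r$ binary projective geometry, i.e. the simple binary matroid on the nonzero vectors of $GF(2)^r$ ($P_0=U_{0,0}$ is the empty matroid). $A_r=AG(r-1,2)$ is the rank-$r$ binary affine geometry, i.e. the restriction of $P_r$ to the complement of a hyperplane of $P_r$. $\mathcal{M}_r$ is the set of all restrictions of the fixed matroid $P_r$ (to arbitrary subsets of $E(P_r)$, including the empty set). For $M\in\mathcal{M}_r$ and $A\subseteq E(P_r)$, $M\triangle A$ denotes the restriction of $P_r$ to the symmetric difference $E(M)\bigtriangleup A$. Operations on $\mathcal{M}_r$: complementation $\omega(M)=M\triangle E(P_r)$; switching with respect to a cocircuit $C^*$ of $P_r$, $\sigma_{C^*}(M)=M\triangle C^*$. Switchings with respect to any cocircuit of $P_r$ are allowed. *)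

theory Defs
  imports Complex_Main "HOL-Library.Z2" "HOL-Library.Function_Algebras"
begin

record 'a matroid =
  ground :: "'a set"
  indeps :: "'a set set"

definition is_matroid :: "'a matroid \<Rightarrow> bool" where
  "is_matroid M \<longleftrightarrow>
     finite (ground M) \<and> {} \<in> indeps M \<and>
     (\<forall>I\<in>indeps M. I \<subseteq> ground M) \<and>
     (\<forall>I\<in>indeps M. \<forall>J. J \<subseteq> I \<longrightarrow> J \<in> indeps M) \<and>
     (\<forall>I\<in>indeps M. \<forall>J\<in>indeps M. card J < card I \<longrightarrow>
        (\<exists>e\<in>I - J. insert e J \<in> indeps M))"

definition mrestrict :: "'a matroid \<Rightarrow> 'a set \<Rightarrow> 'a matroid" where
  "mrestrict M X = \<lparr>ground = ground M \<inter> X, indeps = {I \<in> indeps M. I \<subseteq> X}\<rparr>"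

definition matroid_iso :: "'a matroid \<Rightarrow> 'b matroid \<Rightarrow> bool" (infix "\<cong>\<^sub>M" 50) where
  "M \<cong>\<^sub>M N \<longleftrightarrow>
     (\<exists>\<phi>. bij_betw \<phi> (ground M) (ground N) \<and>
          (\<forall>X. X \<subseteq> ground M \<longrightarrow> (X \<in> indeps M \<longleftrightarrow> \<phi> ` X \<in> indeps N)))"

definition basis :: "'a matroid \<Rightarrow> 'a set \<Rightarrow> bool" where
  "basis M B \<longleftrightarrow> B \<in> indeps M \<and> (\<forall>I\<in>indeps M. B \<subseteq> I \<longrightarrow> I = B)"

definition circuit :: "'a matroid \<Rightarrow> 'a set \<Rightarrow> bool" where
  "circuit M C \<longleftrightarrow>
     C \<subseteq> ground M \<and> C \<notin> indeps M \<and> (\<forall>X. X \<subset> C \<longrightarrow> X \<in> indeps M)"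

(* The bases of the dual are the complements of the bases of M. *)
definition dual :: "'a matroid \<Rightarrow> 'a matroid" where
  "dual M = \<lparr>ground = ground M,
             indeps = {I. \<exists>B. basis M B \<and> I \<subseteq> ground M - B}\<rparr>"

definition cocircuit :: "'a matroid \<Rightarrow> 'a set \<Rightarrow> bool" where
  "cocircuit M C \<longleftrightarrow> circuit (dual M) C"

definition mrank :: "'a matroid \<Rightarrow> 'a set \<Rightarrow> nat" where
  "mrank M X = Max (card ` {I \<in> indeps M. I \<subseteq> X})"

definition flat :: "'a matroid \<Rightarrow> 'a set \<Rightarrow> bool" where
  "flat M F \<longleftrightarrow>
     F \<subseteq> ground M \<and> (\<forall>e\<in>ground M - F. mrank M F < mrank M (insert e F))"

definition hyperplane :: "'a matroid \<Rightarrow> 'a set \<Rightarrow> bool" where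
  "hyperplane M H \<longleftrightarrow> flat M H \<and> mrank M H + 1 = mrank M (ground M)"

definition uniform :: "nat \<Rightarrow> nat \<Rightarrow> nat matroid" where
  "uniform k n = \<lparr>ground = {..<n}, indeps = {I. I \<subseteq> {..<n} \<and> card I \<le> k}\<rparr>"

(* The space GF(2)^r is realised as the set of functions from nat to bit that
   vanish from r on, so that all ranks r live in a single type. *)
type_synonym gf2_vec = "nat \<Rightarrow> bit"

definition gf2_scale :: "bit \<Rightarrow> gf2_vec \<Rightarrow> gf2_vec" where
  "gf2_scale c v = (\<lambda>i. c * v i)"

global_interpretation gf2: vector_space gf2_scale
  by unfold_locales (simp_all only: gf2_scale_def fun_eq_iff plus_fun_def
    distrib_left distrib_right mult.assoc mult_1_left simp_thms)

definition gf2_space :: "nat \<Rightarrow> gf2_vec set" where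
  "gf2_space r = {v. \<forall>i\<ge>r. v i = 0}"

definition vector_matroid :: "gf2_vec set \<Rightarrow> gf2_vec matroid" where
  "vector_matroid S = \<lparr>ground = S, indeps = {I. I \<subseteq> S \<and> gf2.independent I}\<rparr>"

definition PG :: "nat \<Rightarrow> gf2_vec matroid" where
  "PG r = vector_matroid (gf2_space r - {0})"

(* A hyperplane of PG r is not unique, hence a predicate: A is a copy of the
   rank-r binary affine geometry inside PG r. *)
definition is_AG :: "nat \<Rightarrow> gf2_vec matroid \<Rightarrow> bool" where
  "is_AG r A \<longleftrightarrow> (\<exists>H. hyperplane (PG r) H \<and> A = mrestrict (PG r) (ground (PG r) - H))"

definition restrictions_PG :: "nat \<Rightarrow> gf2_vec matroid set" where
  "restrictions_PG r = {mrestrict (PG r) X | X. X \<subseteq> ground (PG r)}"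

definition msym_diff :: "nat \<Rightarrow> gf2_vec matroid \<Rightarrow> gf2_vec set \<Rightarrow> gf2_vec matroid" where
  "msym_diff r M A = mrestrict (PG r) (sym_diff (ground M) A)"

definition complementation :: "nat \<Rightarrow> gf2_vec matroid \<Rightarrow> gf2_vec matroid" where
  "complementation r M = msym_diff r M (ground (PG r))"

definition switching :: "nat \<Rightarrow> gf2_vec set \<Rightarrow> gf2_vec matroid \<Rightarrow> gf2_vec matroid" where
  "switching r C M = msym_diff r M C"

inductive cs_step :: "nat \<Rightarrow> gf2_vec matroid \<Rightarrow> gf2_vec matroid \<Rightarrow> bool" for r where
  complement: "cs_step r M (complementation r M)"
| switch: "cocircuit (PG r) C \<Longrightarrow> cs_step r M (switching r C M)"

definition obtainable_from :: "nat \<Rightarrow> gf2_vec matroid \<Rightarrow> gf2_vec matroid \<Rightarrow> bool" where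
  "obtainable_from r M N \<longleftrightarrow> (cs_step r)\<^sup>*\<^sup>* M N"

lemma finite_gf2_space: "finite (gf2_space r)"
proof -
  have "gf2_space r \<subseteq> (\<lambda>A i. if i \<in> A then 1 else 0) ` Pow {..<r}"
  proof
    fix v assume v: "v \<in> gf2_space r"
    have "v = (\<lambda>i. if i \<in> {i. v i = 1} then 1 else 0)"
      by (auto simp: fun_eq_iff)
    moreover have "{i. v i = 1} \<in> Pow {..<r}"
      using v by (force simp: gf2_space_def intro: ccontr)
    ultimately show "v \<in> (\<lambda>A i. if i \<in> A then 1 else 0) ` Pow {..<r}"
      by blast
  qed
  then show ?thesis
    by (rule finite_subset) simp
qed

lemma is_matroid_vector_matroid:
  assumes "finite S"
  shows "is_matroid (vector_matroid S)"
proof -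
  have "\<exists>e\<in>I - J. insert e J \<subseteq> S \<and> gf2.independent (insert e J)"
    if "I \<subseteq> S" "J \<subseteq> S" "gf2.independent I" "gf2.independent J" "card J < card I" for I J
  proof -
    have "finite J"
      using that(2) assms by (rule finite_subset)
    then have "\<not> I \<subseteq> gf2.span J"
      using gf2.independent_span_bound[of J I] that by auto
    then obtain e where "e \<in> I" "e \<notin> gf2.span J"
      by blast
    moreover from this have "e \<notin> J"
      using gf2.span_base by blast
    ultimately show ?thesis
      using that gf2.independent_insertI[of e J] by blast
  qed
  then show ?thesis
    using assms by (auto simp: is_matroid_def vector_matroid_def gf2.independent_empty
      dest: gf2.independent_mono)
qed

lemma is_matroid_PG: "is_matroid (PG r)"
  unfolding PG_def by (intro is_matroid_vector_matroid finite_Diff finite_gf2_space)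

lemma is_matroid_mrestrict:
  assumes "is_matroid M"
  shows "is_matroid (mrestrict M X)"
proof -
  have "\<exists>e\<in>I - J. insert e J \<in> {I \<in> indeps M. I \<subseteq> X}"
    if IJ: "I \<in> indeps M" "J \<in> indeps M" "I \<subseteq> X" "J \<subseteq> X" "card J < card I" for I J
  proof -
    have "\<exists>e\<in>I - J. insert e J \<in> indeps M"
      using assms IJ(1,2,5) by (simp add: is_matroid_def)
    with IJ(3,4) show ?thesis by auto
  qed
  note exch = this
  have fin: "finite (ground M)" and empty: "{} \<in> indeps M"
    and ground: "\<forall>I\<in>indeps M. I \<subseteq> ground M"
    and sub: "\<forall>I\<in>indeps M. \<forall>J. J \<subseteq> I \<longrightarrow> J \<in> indeps M"
    using assms by (simp_all add: is_matroid_def)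
  show ?thesis
    unfolding is_matroid_def mrestrict_def matroid.simps
  proof (intro conjI ballI allI impI)
    fix I J assume "I \<in> {I \<in> indeps M. I \<subseteq> X}" "J \<subseteq> I"
    then show "J \<in> {I \<in> indeps M. I \<subseteq> X}"
      using sub by blast
  next
    fix I J assume "I \<in> {I \<in> indeps M. I \<subseteq> X}" "J \<in> {I \<in> indeps M. I \<subseteq> X}" "card J < card I"
    then show "\<exists>e\<in>I - J. insert e J \<in> {I \<in> indeps M. I \<subseteq> X}"
      using exch by simp
  qed (use fin empty ground in auto)
qed

end

theory Submission
  imports Defs
begin

text \<open>Cocircuits of \<open>PG r\<close> are the complements \<open>V - W\<close> of linear hyperplanes \<open>W\<close> of \<open>V = GF(2)^r\<close>,
  that is, the supports of nonzero linear functionals. Hence the symmetric difference of two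
  distinct cocircuits is again a cocircuit, and only \<open>E\<close>, the empty set, the cocircuits and
  their complements in \<open>E\<close> can be reached from \<open>E = V - {0}\<close>. That an isomorphism type
  determines which of these subsets of \<open>E\<close> one has is seen by counting points and by looking at the
  triangles \<open>{x, y, x + y}\<close>.\<close>

section \<open>Arithmetic and linear algebra over GF(2)\<close>

lemma gf2_add_self [simp]: "x + x = (0 :: gf2_vec)"
proof
  fix i show "(x + x) i = (0 :: gf2_vec) i" by (cases "x i") simp_all
qed

lemma gf2_add_cancel [simp]: "x + (x + y) = (y :: gf2_vec)"
  by (simp flip: add.assoc)

lemma gf2_minus [simp]: "- x = (x :: gf2_vec)"
  by (metis add_eq_0_iff gf2_add_self)

lemma gf2_diff [simp]: "x - y = x + (y :: gf2_vec)"
  by (metis diff_conv_add_uminus gf2_minus)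

lemma gf2_scale_bit: "gf2_scale c v = (if c = 0 then 0 else v)"
  by (cases c) (auto simp: gf2_scale_def fun_eq_iff)

text \<open>The only scalars are 0 and 1, so closure under scaling amounts to containing 0.\<close>

lemma gf2_subspace_iff: "gf2.subspace S \<longleftrightarrow> 0 \<in> S \<and> (\<forall>x\<in>S. \<forall>y\<in>S. x + y \<in> S)"
  unfolding gf2.subspace_def gf2_scale_bit by auto

text \<open>The coefficient of \<open>a\<close> in a linear combination is 0 or 1, which gives the
  two translates.\<close>

lemma gf2_span_insert: "gf2.span (insert a S) = gf2.span S \<union> (+) a ` gf2.span S"
proof -
  have "x \<in> (+) a ` T \<longleftrightarrow> a + x \<in> T" for x and T :: "gf2_vec set"
    by (metis (no_types, opaque_lifting) gf2_add_cancel image_iff)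
  then show ?thesis
    by (auto simp: gf2.span_insert gf2_scale_bit add.commute[of _ a])
qed

lemma subspace_gf2_space: "gf2.subspace (gf2_space r)"
  unfolding gf2_subspace_iff by (auto simp: gf2_space_def)

lemmas zero_in_gf2_space = gf2.subspace_0[OF subspace_gf2_space]
lemmas add_in_gf2_space = gf2.subspace_add[OF subspace_gf2_space]

text \<open>Two distinct nonzero vectors are independent over GF(2), and their span has just one
  further nonzero element, their sum. This lets the matroid structure see addition, which is what
  the arguments with triangles rest on.\<close>

lemma gf2_triple_dependent_iff:
  fixes x y z :: gf2_vec
  assumes "x \<noteq> 0" "y \<noteq> 0" "x \<noteq> y" "z \<noteq> 0" "x \<noteq> z" "y \<noteq> z"
  shows "gf2.dependent {x, y, z} \<longleftrightarrow> z = x + y"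
proof -
  have y: "gf2.independent {y}" using assms by (simp add: gf2.dependent_single)
  have "gf2.span {y} = {0, y}" by (auto simp: gf2_span_insert)
  then have sp: "gf2.span {x, y} = {0, y, x, x + y}" and "x \<notin> gf2.span {y}"
    using assms by (auto simp: gf2_span_insert[of x])
  then have "gf2.independent {x, y}"
    using y assms by (simp add: gf2.independent_insert)
  then have "gf2.dependent {x, y, z} \<longleftrightarrow> z \<in> gf2.span {x, y}"
    using assms gf2.independent_insert[of z "{x, y}"] by (simp add: insert_commute)
  then show ?thesis
    using sp assms by simp
qed

section \<open>Restrictions of the projective geometry as vector matroids\<close>

lemma ground_vector_matroid [simp]: "ground (vector_matroid S) = S"
  by (simp add: vector_matroid_def)

lemma indeps_vector_matroid: "I \<in> indeps (vector_matroid S) \<longleftrightarrow> I \<subseteq> S \<and> gf2.independent I"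
  by (simp add: vector_matroid_def)

lemma ground_PG: "ground (PG r) = gf2_space r - {0}"
  by (simp add: PG_def)

lemma finite_subset_PG: "S \<subseteq> ground (PG r) \<Longrightarrow> finite S"
  using finite_gf2_space by (metis finite_Diff finite_subset ground_PG)

lemma indeps_PG: "I \<in> indeps (PG r) \<longleftrightarrow> I \<subseteq> gf2_space r - {0} \<and> gf2.independent I"
  by (simp add: PG_def indeps_vector_matroid)

lemma mrestrict_PG:
  assumes "X \<subseteq> ground (PG r)"
  shows "mrestrict (PG r) X = vector_matroid X"
  using assms by (auto simp: mrestrict_def vector_matroid_def PG_def)

lemma msym_diff_PG:
  assumes "X \<subseteq> ground (PG r)" "A \<subseteq> ground (PG r)"
  shows "msym_diff r (vector_matroid X) A = vector_matroid (sym_diff X A)"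
  unfolding msym_diff_def using assms by (subst mrestrict_PG) auto

section \<open>Linear hyperplanes of GF(2)^r\<close>

text \<open>The closure condition says that the indicator function of the complement of \<open>W\<close> is
  linear; with \<open>W\<close> proper, \<open>W\<close> is the kernel of a nonzero functional.\<close>

definition linear_hyperplane :: "nat \<Rightarrow> gf2_vec set \<Rightarrow> bool" where
  "linear_hyperplane r W \<longleftrightarrow> W \<subset> gf2_space r \<and>
     (\<forall>x\<in>gf2_space r. \<forall>y\<in>gf2_space r. x + y \<in> W \<longleftrightarrow> (x \<in> W \<longleftrightarrow> y \<in> W))"

lemma linear_hyperplane_subset: "linear_hyperplane r W \<Longrightarrow> W \<subseteq> gf2_space r"
  by (auto simp: linear_hyperplane_def)

lemma linear_hyperplane_add:
  "linear_hyperplane r W \<Longrightarrow> x \<in> gf2_space r \<Longrightarrow> y \<in> gf2_space r \<Longrightarrow>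
    x + y \<in> W \<longleftrightarrow> (x \<in> W \<longleftrightarrow> y \<in> W)"
  by (simp add: linear_hyperplane_def)

lemma linear_hyperplane_subspace:
  assumes "linear_hyperplane r W"
  shows "gf2.subspace W"
proof -
  have "0 \<in> W"
    using linear_hyperplane_add[OF assms, of 0 0] zero_in_gf2_space by simp
  then show ?thesis
    using assms linear_hyperplane_subset[OF assms]
    by (auto simp: gf2_subspace_iff linear_hyperplane_add subset_iff)
qed

lemma linear_hyperplane_zero: "linear_hyperplane r W \<Longrightarrow> 0 \<in> W"
  using linear_hyperplane_subspace gf2.subspace_0 by blast

text \<open>Translation by a vector outside \<open>W\<close> exchanges \<open>W\<close> with its
  complement.\<close>

lemma linear_hyperplane_card:
  assumes "linear_hyperplane r W"
  shows "2 * card W = card (gf2_space r)"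
proof -
  obtain a where a: "a \<in> gf2_space r" "a \<notin> W"
    using assms by (auto simp: linear_hyperplane_def)
  have "bij_betw ((+) a) W (gf2_space r - W)"
    using a assms linear_hyperplane_subset[OF assms]
    by (intro bij_betw_byWitness[where f' = "(+) a"])
      (auto simp: linear_hyperplane_add add_in_gf2_space subset_iff)
  then have "card (gf2_space r - W) = card W"
    by (rule bij_betw_same_card[symmetric])
  moreover have "card (gf2_space r) = card W + card (gf2_space r - W)"
    using linear_hyperplane_subset[OF assms] finite_gf2_space
    by (metis card_Diff_subset card_mono finite_subset le_add_diff_inverse)
  ultimately show ?thesis by simp
qed

text \<open>For \<open>x\<close> outside \<open>W\<close> the coset \<open>x + W\<close> misses
  \<open>W\<close> and, by size, is the whole complement. Any two vectors outside \<open>W\<close>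
  thus lie in one coset, so that their sum is in \<open>W\<close>.\<close>

lemma linear_hyperplane_if_card:
  assumes sub: "W \<subseteq> gf2_space r" and W: "gf2.subspace W"
    and card: "2 * card W = card (gf2_space r)"
  shows "linear_hyperplane r W"
proof -
  let ?V = "gf2_space r"
  have fin: "finite W" using sub finite_gf2_space by (rule finite_subset)
  have pos: "card W > 0" using fin gf2.subspace_0[OF W] by (auto simp: card_gt_0_iff)
  have key: "x + y \<in> W" if xy: "x \<in> ?V - W" "y \<in> ?V - W" for x y
  proof -
    have "(+) x ` W \<subseteq> ?V - W"
    proof safe
      fix w assume w: "w \<in> W"
      show "x + w \<in> ?V" using w xy sub by (auto intro: add_in_gf2_space)
      assume "x + w \<in> W"
      then have "w + (x + w) \<in> W" using w W unfolding gf2_subspace_iff by blast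
      then show False using xy by (simp add: add.commute[of x])
    qed
    moreover have "card ((+) x ` W) = card (?V - W)"
      using card sub fin by (simp add: card_image card_Diff_subset)
    ultimately have "(+) x ` W = ?V - W"
      using finite_gf2_space by (intro card_subset_eq) auto
    then obtain w where "w \<in> W" "y = x + w" using xy by blast
    then show ?thesis by simp
  qed
  have "x + y \<notin> W" if "x \<in> W" "y \<in> ?V - W" for x y
    using that W by (metis DiffD2 gf2_add_cancel gf2_subspace_iff)
  then show ?thesis
    unfolding linear_hyperplane_def
    using sub card pos key W
    by (auto simp: gf2_subspace_iff) (metis DiffI add.commute)+
qed

lemma linear_hyperplane_span_insert:
  assumes W: "linear_hyperplane r W" and a: "a \<in> gf2_space r - W"
  shows "gf2.span (insert a W) = gf2_space r"
proof
  show "gf2.span (insert a W) \<subseteq> gf2_space r"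
    using a linear_hyperplane_subset[OF W] by (intro gf2.span_minimal subspace_gf2_space) auto
  show "gf2_space r \<subseteq> gf2.span (insert a W)"
  proof
    fix x assume x: "x \<in> gf2_space r"
    then have "x \<in> W \<or> a + x \<in> W"
      using linear_hyperplane_add[OF W, of a x] a by auto
    then show "x \<in> gf2.span (insert a W)"
      by (metis UnI1 UnI2 gf2.span_base gf2_add_cancel gf2_span_insert image_eqI)
  qed
qed

text \<open>By maximality \<open>W\<close> and \<open>x + W\<close> cover the space for every
  \<open>x\<close> outside \<open>W\<close>, so any \<open>y\<close> outside \<open>W\<close> lies
  in \<open>x + W\<close>, which puts \<open>x + y\<close> into \<open>W\<close>.\<close>

lemma linear_hyperplane_if_maximal:
  assumes sub: "W \<subset> gf2_space r" and W: "gf2.subspace W"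
    and max: "\<And>a. a \<in> gf2_space r - W \<Longrightarrow> gf2_space r \<subseteq> gf2.span (insert a W)"
  shows "linear_hyperplane r W"
proof -
  let ?V = "gf2_space r"
  have key: "x + y \<in> W" if xy: "x \<in> ?V - W" "y \<in> ?V - W" for x y
  proof -
    have "y \<in> W \<union> (+) x ` W"
      using max[OF xy(1)] xy W by (auto simp: gf2_span_insert gf2.span_eq_iff[THEN iffD2])
    then show ?thesis using xy by auto
  qed
  have "x + y \<notin> W" if "x \<in> W" "y \<in> ?V - W" for x y
    using that W by (metis DiffD2 gf2_add_cancel gf2_subspace_iff)
  then show ?thesis
    unfolding linear_hyperplane_def
    using sub key W
    by (auto simp: gf2_subspace_iff) (metis DiffI add.commute)+
qed

lemma linear_hyperplane_pred:
  assumes "r \<ge> 1"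
  shows "linear_hyperplane r (gf2_space (r - 1))"
proof -
  have eq: "gf2_space (r - 1) = {v \<in> gf2_space r. v (r - 1) = 0}"
  proof -
    have "i \<ge> r - 1 \<longleftrightarrow> i \<ge> r \<or> i = r - 1" for i using assms by auto
    then show ?thesis by (auto simp: gf2_space_def)
  qed
  \<comment> \<open>The last unit vector shows properness. It lies in \<open>gf2_space r\<close>
    because \<open>r \<ge> 1\<close> gives \<open>r - 1 < r\<close>.\<close>
  have "(\<lambda>i. if i = r - 1 then 1 else 0) \<in> gf2_space r - gf2_space (r - 1)"
    using assms by (auto simp: gf2_space_def)
  then have "gf2_space (r - 1) \<subset> gf2_space r" using eq by blast
  moreover have "(a + b = 0) \<longleftrightarrow> ((a = 0) \<longleftrightarrow> (b = 0))" for a b :: bit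
    by (cases a; cases b) simp_all
  ultimately show ?thesis
    unfolding linear_hyperplane_def eq
    by (simp add: add_in_gf2_space del: add_bit_eq_xor)
qed

section \<open>Bases, cocircuits, rank and hyperplanes of the projective geometry\<close>

text \<open>A vector outside the span of an independent set could be added to it, and a vector
  inside the span makes every extension by it dependent; so for independent sets maximal means
  spanning.\<close>

lemma basis_PG_iff:
  "basis (PG r) B \<longleftrightarrow> B \<subseteq> gf2_space r - {0} \<and> gf2.independent B \<and> gf2_space r \<subseteq> gf2.span B"
proof
  assume B: "basis (PG r) B"
  then have 1: "B \<subseteq> gf2_space r - {0}" "gf2.independent B"
    by (auto simp: basis_def indeps_PG)
  have "x \<in> gf2.span B" if x: "x \<in> gf2_space r" for x
  proof (rule ccontr)
    assume nx: "x \<notin> gf2.span B"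
    then have "x \<noteq> 0" "x \<notin> B" using gf2.span_zero gf2.span_base by auto
    then have "insert x B \<in> indeps (PG r)"
      using 1 x nx gf2.independent_insertI[of x B] by (auto simp: indeps_PG)
    then show False using B \<open>x \<notin> B\<close> unfolding basis_def by blast
  qed
  then show "B \<subseteq> gf2_space r - {0} \<and> gf2.independent B \<and> gf2_space r \<subseteq> gf2.span B"
    using 1 by blast
next
  assume B: "B \<subseteq> gf2_space r - {0} \<and> gf2.independent B \<and> gf2_space r \<subseteq> gf2.span B"
  have max: "I = B" if I: "I \<subseteq> gf2_space r" "gf2.independent I" "B \<subseteq> I" for I
  proof (rule ccontr)
    assume "I \<noteq> B"
    then obtain x where x: "x \<in> I" "x \<notin> B" using I by blast
    then have "x \<in> gf2.span B" using B I by blast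
    then have "x \<in> gf2.span (I - {x})" using gf2.span_mono[of B "I - {x}"] x I by blast
    then show False using I x unfolding gf2.dependent_def by blast
  qed
  show "basis (PG r) B"
    unfolding basis_def indeps_PG
  proof (intro conjI ballI impI)
    fix I assume "I \<in> indeps (PG r)" "B \<subseteq> I"
    then show "I = B" by (intro max) (auto simp: indeps_PG)
  qed (use B in auto)
qed

lemma exists_basis_PG_subset_iff:
  assumes "S \<subseteq> gf2_space r - {0}"
  shows "(\<exists>B. basis (PG r) B \<and> B \<subseteq> S) \<longleftrightarrow> gf2_space r \<subseteq> gf2.span S"
proof
  assume "\<exists>B. basis (PG r) B \<and> B \<subseteq> S"
  then show "gf2_space r \<subseteq> gf2.span S"
    using gf2.span_mono unfolding basis_PG_iff by blast
next
  assume S: "gf2_space r \<subseteq> gf2.span S"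
  obtain B where B: "B \<subseteq> S" "gf2.independent B" "S \<subseteq> gf2.span B"
    by (rule gf2.maximal_independent_subset)
  then have "gf2.span S \<subseteq> gf2.span B"
    by (intro gf2.span_minimal gf2.subspace_span)
  then have "basis (PG r) B"
    using S B(1,2) assms unfolding basis_PG_iff by (intro conjI) simp_all
  then show "\<exists>B. basis (PG r) B \<and> B \<subseteq> S"
    using B(1) by (intro exI conjI)
qed

text \<open>A set avoids some basis exactly if its complement contains one, that is, if its
  complement spans.\<close>

lemma indeps_dual_PG:
  "I \<in> indeps (dual (PG r)) \<longleftrightarrow>
    I \<subseteq> gf2_space r - {0} \<and> gf2_space r \<subseteq> gf2.span (gf2_space r - {0} - I)"
proof -
  let ?E = "gf2_space r - {0}"
  have "I \<subseteq> ?E - B \<longleftrightarrow> I \<subseteq> ?E \<and> B \<subseteq> ?E - I" if "basis (PG r) B" for B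
    using that unfolding basis_PG_iff by blast
  then have "I \<in> indeps (dual (PG r)) \<longleftrightarrow> I \<subseteq> ?E \<and> (\<exists>B. basis (PG r) B \<and> B \<subseteq> ?E - I)"
    unfolding dual_def ground_PG by (simp cong: conj_cong) blast
  then show ?thesis
    using exists_basis_PG_subset_iff[of "?E - I" r] by (simp add: Diff_subset)
qed

text \<open>A cocircuit is a minimal set whose removal destroys spanning. The hyperplane is the span
  \<open>W\<close> of the remaining points: minimality makes \<open>W\<close> a maximal proper
  subspace. Conversely, removing everything outside \<open>W\<close> leaves \<open>W - {0}\<close>,
  and giving back any single point restores the full span.\<close>

lemma cocircuit_PG_iff:
  "cocircuit (PG r) C \<longleftrightarrow> (\<exists>W. linear_hyperplane r W \<and> C = gf2_space r - W)"
proof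
  let ?V = "gf2_space r"
  assume "cocircuit (PG r) C"
  then have CE: "C \<subseteq> ?V - {0}"
    and dep: "\<not> ?V \<subseteq> gf2.span (?V - {0} - C)"
    and min: "\<And>X. X \<subset> C \<Longrightarrow> ?V \<subseteq> gf2.span (?V - {0} - X)"
    unfolding cocircuit_def circuit_def indeps_dual_PG by (auto simp: dual_def ground_PG)
  define W where "W = gf2.span (?V - {0} - C)"
  have WV: "W \<subseteq> ?V"
    unfolding W_def by (intro gf2.span_minimal subspace_gf2_space) auto
  have sup: "?V - C \<subseteq> W"
    using gf2.span_zero[of "?V - {0} - C"] gf2.span_superset[of "?V - {0} - C"]
    unfolding W_def by auto
  have full: "?V \<subseteq> gf2.span (insert a (?V - {0} - C))" if a: "a \<in> C" for a
  proof -
    have "?V - {0} - (C - {a}) = insert a (?V - {0} - C)" using a CE by auto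
    then show ?thesis using min[of "C - {a}"] a by auto
  qed
  \<comment> \<open>A point of \<open>C\<close> inside \<open>W\<close> would be redundant: giving
    it back would not enlarge the span, contrary to \<open>full\<close>.\<close>
  have disj: "C \<inter> W = {}"
  proof (rule ccontr)
    assume "C \<inter> W \<noteq> {}"
    then obtain a where a: "a \<in> C" "a \<in> W" by blast
    then have "gf2.span (insert a (?V - {0} - C)) = W"
      unfolding W_def by (intro gf2.span_redundant)
    then show False using full[OF a(1)] dep unfolding W_def by simp
  qed
  have "linear_hyperplane r W"
  proof (rule linear_hyperplane_if_maximal)
    show "W \<subset> ?V" using WV dep unfolding W_def by blast
    show "gf2.subspace W" unfolding W_def by (rule gf2.subspace_span)
    fix a assume "a \<in> ?V - W"
    then have "?V \<subseteq> gf2.span (insert a (?V - {0} - C))" using sup by (intro full) auto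
    also have "\<dots> \<subseteq> gf2.span (insert a W)"
      unfolding W_def by (intro gf2.span_mono insert_mono gf2.span_superset)
    finally show "?V \<subseteq> gf2.span (insert a W)" .
  qed
  moreover have "C = ?V - W" using sup disj CE by auto
  ultimately show "\<exists>W. linear_hyperplane r W \<and> C = ?V - W" by blast
next
  let ?V = "gf2_space r"
  assume "\<exists>W. linear_hyperplane r W \<and> C = ?V - W"
  then obtain W where W: "linear_hyperplane r W" and C: "C = ?V - W" by blast
  note WV = linear_hyperplane_subset[OF W] and W0 = linear_hyperplane_zero[OF W]
  have eq: "?V - {0} - C = W - {0}" using WV unfolding C by auto
  have "gf2.span (W - {0}) \<subseteq> W"
    using linear_hyperplane_subspace[OF W] by (intro gf2.span_minimal) auto
  then have "\<not> ?V \<subseteq> gf2.span (?V - {0} - C)"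
    unfolding eq using W unfolding linear_hyperplane_def by (metis order.trans psubsetE)
  moreover have "?V \<subseteq> gf2.span (?V - {0} - X)" if X: "X \<subset> C" for X
  proof -
    obtain a where a: "a \<in> C" "a \<notin> X" using X by blast
    have "?V = gf2.span (insert a W)"
      using linear_hyperplane_span_insert[OF W, of a] a C by simp
    also have "\<dots> = gf2.span (insert a W - {0})" by simp
    also have "\<dots> \<subseteq> gf2.span (?V - {0} - X)"
      using X a WV unfolding C by (intro gf2.span_mono) auto
    finally show ?thesis .
  qed
  ultimately show "cocircuit (PG r) C"
    using W0 unfolding cocircuit_def circuit_def indeps_dual_PG
    by (auto simp: dual_def ground_PG C)
qed

text \<open>By Steinitz exchange no independent subset of the span of \<open>B\<close> is larger
  than \<open>B\<close>.\<close>

lemma mrank_PG: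
  assumes X: "X \<subseteq> ground (PG r)" and B: "B \<subseteq> X" "gf2.independent B" "X \<subseteq> gf2.span B"
  shows "mrank (PG r) X = card B"
proof -
  have fin: "finite X" using X by (rule finite_subset_PG)
  have finB: "finite B" using B fin finite_subset by blast
  have eq: "{I \<in> indeps (PG r). I \<subseteq> X} = {I. I \<subseteq> X \<and> gf2.independent I}"
    using X by (auto simp: indeps_PG ground_PG)
  show ?thesis unfolding mrank_def eq
  proof (rule Max_eqI)
    show "finite (card ` {I. I \<subseteq> X \<and> gf2.independent I})" using fin by simp
    show "card B \<in> card ` {I. I \<subseteq> X \<and> gf2.independent I}" using B by blast
    fix k assume "k \<in> card ` {I. I \<subseteq> X \<and> gf2.independent I}"
    then show "k \<le> card B" using gf2.independent_span_bound[OF finB] B by blast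
  qed
qed

text \<open>Let \<open>B\<close> be a maximal independent subset of \<open>H\<close> and
  \<open>W\<close> its span. Adding a point of \<open>W\<close> to \<open>H\<close> would not raise
  the rank, so flatness gives \<open>H = W - {0}\<close>; the rank being one below the full rank
  makes \<open>W\<close> maximal. For the converse, any one point outside \<open>W\<close> raises
  the rank to the full one.\<close>

lemma hyperplane_PG_iff:
  "hyperplane (PG r) H \<longleftrightarrow> (\<exists>W. linear_hyperplane r W \<and> H = W - {0})"
proof
  let ?V = "gf2_space r"
  assume hyp: "hyperplane (PG r) H"
  then have HE: "H \<subseteq> ground (PG r)"
    and flat: "\<And>e. e \<in> ground (PG r) - H \<Longrightarrow> mrank (PG r) H < mrank (PG r) (insert e H)"
    and rk: "mrank (PG r) H + 1 = mrank (PG r) (ground (PG r))"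
    by (auto simp: hyperplane_def flat_def)
  obtain B where B: "B \<subseteq> H" "gf2.independent B" "H \<subseteq> gf2.span B"
    by (rule gf2.maximal_independent_subset)
  obtain D where D: "D \<subseteq> ground (PG r)" "gf2.independent D" "ground (PG r) \<subseteq> gf2.span D"
    by (rule gf2.maximal_independent_subset)
  have finB: "finite B"
    using B HE by (intro finite_subset_PG) auto
  have card: "card D = card B + 1"
    using rk mrank_PG[OF HE B] mrank_PG[OF subset_refl D] by simp
  define W where "W = gf2.span B"
  have WV: "W \<subseteq> ?V" unfolding W_def
    using B HE by (intro gf2.span_minimal subspace_gf2_space) (auto simp: ground_PG)
  have "W - {0} \<subseteq> H"
  proof (rule ccontr)
    assume "\<not> W - {0} \<subseteq> H"
    then obtain e where e: "e \<in> W" "e \<noteq> 0" "e \<notin> H" by blast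
    then have eE: "e \<in> ground (PG r)" using WV by (auto simp: ground_PG)
    have "mrank (PG r) (insert e H) = card B"
      using B HE e eE unfolding W_def by (intro mrank_PG) auto
    then show False using flat[of e] e eE mrank_PG[OF HE B] by simp
  qed
  then have H: "H = W - {0}" using B HE unfolding W_def by (auto simp: ground_PG)
  have "linear_hyperplane r W"
  proof (rule linear_hyperplane_if_maximal)
    have "\<not> D \<subseteq> W"
      using gf2.independent_span_bound[OF finB D(2)] card unfolding W_def by auto
    then show "W \<subset> ?V" using WV D by (auto simp: ground_PG)
    show "gf2.subspace W" unfolding W_def by (rule gf2.subspace_span)
    fix a assume a: "a \<in> ?V - W"
    then have ind: "gf2.independent (insert a B)"
      using B unfolding W_def by (intro gf2.independent_insertI) auto
    have aB: "a \<notin> B" using a gf2.span_base unfolding W_def by blast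
    have le: "gf2.span (insert a B) \<subseteq> gf2.span (insert a W)"
      unfolding W_def by (intro gf2.span_mono insert_mono gf2.span_superset)
    show "?V \<subseteq> gf2.span (insert a W)"
    proof (rule ccontr)
      \<comment> \<open>Otherwise \<open>B\<close> extends by \<open>a\<close> and a further
        \<open>x\<close> to an independent set with one element more than \<open>D\<close>.\<close>
      assume "\<not> ?V \<subseteq> gf2.span (insert a W)"
      then obtain x where x: "x \<in> ?V" "x \<notin> gf2.span (insert a B)" using le by blast
      then have ind': "gf2.independent (insert x (insert a B))"
        by (intro gf2.independent_insertI[OF _ ind])
      have xB: "x \<notin> insert a B" using x gf2.span_base by blast
      have "?V \<subseteq> gf2.span D"
        using D(3) gf2.span_zero[of D] by (auto simp: ground_PG)
      then have "insert x (insert a B) \<subseteq> gf2.span D"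
        using x a WV gf2.span_superset[of B] unfolding W_def by blast
      moreover have "finite D"
        using D by (intro finite_subset_PG)
      ultimately have "card (insert x (insert a B)) \<le> card D"
        using gf2.independent_span_bound ind' by blast
      then show False using card xB aB finB by simp
    qed
  qed
  then show "\<exists>W. linear_hyperplane r W \<and> H = W - {0}" using H by blast
next
  let ?V = "gf2_space r"
  assume "\<exists>W. linear_hyperplane r W \<and> H = W - {0}"
  then obtain W where W: "linear_hyperplane r W" and H: "H = W - {0}" by blast
  note WV = linear_hyperplane_subset[OF W] and W0 = linear_hyperplane_zero[OF W]
  have HE: "H \<subseteq> ground (PG r)" using WV H by (auto simp: ground_PG)
  obtain B where B: "B \<subseteq> H" "gf2.independent B" "H \<subseteq> gf2.span B"
    by (rule gf2.maximal_independent_subset)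
  have finB: "finite B"
    using B HE by (intro finite_subset_PG) auto
  have spB: "gf2.span B = W"
  proof
    show "gf2.span B \<subseteq> W"
      using B H linear_hyperplane_subspace[OF W] by (intro gf2.span_minimal) auto
    show "W \<subseteq> gf2.span B" using B(3) H gf2.span_zero[of B] by auto
  qed
  \<comment> \<open>Used with \<open>Y\<close> the whole ground set for the rank condition and with
    \<open>Y = insert e H\<close> for flatness.\<close>
  have rank_ext: "mrank (PG r) Y = card B + 1"
    if Y: "insert e H \<subseteq> Y" "Y \<subseteq> ground (PG r)" and e: "e \<in> ?V - W" for e Y
  proof -
    have "gf2.span (insert e B) = gf2.span (insert e W)"
      using spB by (metis gf2.span_insert gf2.span_span)
    then have sp: "gf2.span (insert e B) = ?V"
      using linear_hyperplane_span_insert[OF W e] by simp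
    have "e \<notin> B" using e B H by blast
    then have "card (insert e B) = card B + 1" using finB by simp
    moreover have "mrank (PG r) Y = card (insert e B)"
      using Y B e spB sp by (intro mrank_PG gf2.independent_insertI) (auto simp: ground_PG)
    ultimately show ?thesis by simp
  qed
  obtain a where a: "a \<in> ?V - W" using W by (auto simp: linear_hyperplane_def)
  have "mrank (PG r) (ground (PG r)) = card B + 1"
    using rank_ext[of a "ground (PG r)"] a HE W0 by (auto simp: ground_PG)
  moreover have "mrank (PG r) H = card B" by (rule mrank_PG[OF HE B])
  moreover have "mrank (PG r) (insert e H) = card B + 1" if "e \<in> ground (PG r) - H" for e
    using that HE H by (intro rank_ext[of e]) (auto simp: ground_PG)
  ultimately show "hyperplane (PG r) H"
    using HE by (simp add: hyperplane_def flat_def)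
qed

lemma is_AG_iff:
  "is_AG r A \<longleftrightarrow> (\<exists>W. linear_hyperplane r W \<and> A = vector_matroid (gf2_space r - W))"
proof -
  have "mrestrict (PG r) (ground (PG r) - (W - {0})) = vector_matroid (gf2_space r - W)"
    if "linear_hyperplane r W" for W
  proof -
    have "ground (PG r) - (W - {0}) = gf2_space r - W"
      using linear_hyperplane_zero[OF that] by (auto simp: ground_PG)
    then show ?thesis using mrestrict_PG[of "gf2_space r - W" r] by (metis Diff_subset)
  qed
  then show ?thesis unfolding is_AG_def hyperplane_PG_iff by metis
qed

section \<open>Isomorphisms between vector matroids\<close>

text \<open>Injectivity is asked on a subspace \<open>W\<close> around \<open>S\<close> because
  preserving independence needs it on spans of subsets of \<open>S\<close>, not just on
  \<open>S\<close>. In the other direction a linear dependence is simply mapped forward by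
  \<open>f\<close>.\<close>

lemma linear_inj_vector_matroid_iso:
  assumes f: "module_hom gf2_scale gf2_scale f" and inj: "inj_on f W"
    and W: "gf2.subspace W" and sub: "S \<subseteq> W"
  shows "vector_matroid S \<cong>\<^sub>M vector_matroid (f ` S)"
proof -
  interpret module_hom gf2_scale gf2_scale f by (rule f)
  have "gf2.independent X \<longleftrightarrow> gf2.independent (f ` X)" if X: "X \<subseteq> S" for X
  proof
    assume "gf2.independent X"
    moreover have "gf2.span X \<subseteq> W" using X sub W by (intro gf2.span_minimal) auto
    ultimately show "gf2.independent (f ` X)"
      using inj by (intro independent_injective_image) (auto intro: inj_on_subset)
  next
    assume ind: "gf2.independent (f ` X)"
    have "inj_on f X" using inj X sub by (auto intro: inj_on_subset)
    then have "f ` (X - {x}) = f ` X - {f x}" if "x \<in> X" for x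
      using that by (auto simp: inj_on_def)
    then show "gf2.independent X"
      using ind span_image unfolding gf2.dependent_def by (metis imageI)
  qed
  then show ?thesis
    unfolding matroid_iso_def using inj sub
    by (intro exI[of _ f]) (auto simp: indeps_vector_matroid bij_betw_def intro: inj_on_subset)
qed

text \<open>Some unit vector \<open>e\<^sub>k\<close> lies outside \<open>W\<close>, and deleting the coordinate \<open>k\<close>, a linear map
  with kernel \<open>{0, e\<^sub>k}\<close>, then maps \<open>W\<close> isomorphically onto a coordinate space.\<close>

lemma linear_hyperplane_iso_PG:
  assumes W: "linear_hyperplane r W"
  shows "vector_matroid (W - {0}) \<cong>\<^sub>M PG (r - 1)"
proof -
  let ?V = "gf2_space r"
  define u :: "nat \<Rightarrow> gf2_vec" where "u k = (\<lambda>i. if i = k then 1 else 0)" for k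
  have "\<exists>k<r. u k \<notin> W"
  proof (rule ccontr)
    assume *: "\<not> (\<exists>k<r. u k \<notin> W)"
    \<comment> \<open>If \<open>W\<close> contained all unit vectors it would be the whole space: by
      induction on the number of coordinates, a nonzero coordinate \<open>n\<close> is cleared by
      adding \<open>u n\<close>.\<close>
    have "gf2_space n \<subseteq> W" if "n \<le> r" for n
      using that
    proof (induction n)
      case 0
      have "gf2_space 0 = {0}" by (auto simp: gf2_space_def fun_eq_iff)
      then show ?case using linear_hyperplane_zero[OF W] by simp
    next
      case (Suc n)
      show ?case
      proof
        fix v assume v: "v \<in> gf2_space (Suc n)"
        have un: "u n \<in> W" using * Suc by auto
        show "v \<in> W"
        proof (cases "v n = 0")
          case True
          have "v i = 0" if "i \<ge> n" for i
            using v True that by (cases "i = n") (auto simp: gf2_space_def)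
          then show ?thesis using Suc by (auto simp: gf2_space_def)
        next
          case False
          have "(u n + v) i = 0" if "i \<ge> n" for i
            using v False that by (cases "i = n") (auto simp: gf2_space_def u_def)
          then have "u n + v \<in> W" using Suc by (auto simp: gf2_space_def)
          then have "u n + (u n + v) \<in> W"
            using un linear_hyperplane_subspace[OF W] unfolding gf2_subspace_iff by blast
          then show ?thesis by simp
        qed
      qed
    qed
    then show False using W by (auto simp: linear_hyperplane_def)
  qed
  then obtain k where k: "k < r" "u k \<notin> W" by blast
  have uV: "u k \<in> ?V" using k by (auto simp: gf2_space_def u_def)
  define f :: "gf2_vec \<Rightarrow> gf2_vec" where "f v = (\<lambda>i. v (if i < k then i else Suc i))" for v
  have hom: "module_hom gf2_scale gf2_scale f"
    by unfold_locales (auto simp: f_def gf2_scale_def fun_eq_iff)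
  have ker: "v = 0 \<or> v = u k" if "f v = 0" for v
  proof -
    have "v i = 0" if ne: "i \<noteq> k" for i
    proof (cases "i < k")
      case True
      then show ?thesis using fun_cong[OF \<open>f v = 0\<close>, of i] by (simp add: f_def)
    next
      case False
      then obtain j where "i = Suc j" "\<not> j < k" using False ne by (cases i) auto
      then show ?thesis using fun_cong[OF \<open>f v = 0\<close>, of j] by (simp add: f_def)
    qed
    then have "v i = 0 i" if "v k = 0" for i
      using that by (cases "i = k") simp_all
    moreover have "v i = u k i" if "v k \<noteq> 0" for i
      using that \<open>\<And>i. i \<noteq> k \<Longrightarrow> v i = 0\<close> by (cases "i = k") (simp_all add: u_def)
    ultimately show ?thesis by (metis ext)
  qed
  have inj: "inj_on f W"
  proof (rule inj_onI)
    fix x y assume xy: "x \<in> W" "y \<in> W" "f x = f y"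
    then have "f (x + y) = 0" using module_hom.add[OF hom, of x y] by simp
    moreover have "x + y \<in> W"
      using xy linear_hyperplane_subspace[OF W] by (auto simp: gf2_subspace_iff)
    ultimately have "x + y = 0" using ker[of "x + y"] k(2) by metis
    then show "x = y" by (metis add.right_neutral gf2_add_cancel)
  qed
  have img: "f ` W = gf2_space (r - 1)"
  proof
    have "f v \<in> gf2_space (r - 1)" if "v \<in> W" for v
      using that linear_hyperplane_subset[OF W] k by (auto simp: gf2_space_def f_def)
    then show "f ` W \<subseteq> gf2_space (r - 1)" by blast
    show "gf2_space (r - 1) \<subseteq> f ` W"
    proof
      fix w assume w: "w \<in> gf2_space (r - 1)"
      \<comment> \<open>\<open>v\<close> is \<open>w\<close> with a 0 inserted at position
        \<open>k\<close>. Since \<open>f\<close> kills \<open>u k\<close>, both \<open>v\<close> and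
        \<open>u k + v\<close> are preimages of \<open>w\<close>, and as \<open>u k\<close> is
        outside \<open>W\<close> one of the two lies in \<open>W\<close>.\<close>
      define v :: gf2_vec where "v = (\<lambda>i. if i < k then w i else if i = k then 0 else w (i - 1))"
      have vV: "v \<in> ?V" using w k by (auto simp: gf2_space_def v_def)
      have fv: "f v = w" by (auto simp: f_def v_def fun_eq_iff)
      have fu: "f (u k) = 0" by (auto simp: f_def u_def fun_eq_iff)
      show "w \<in> f ` W"
      proof (cases "v \<in> W")
        case True
        then show ?thesis using fv by blast
      next
        case False
        then have "u k + v \<in> W" using linear_hyperplane_add[OF W uV vV] k by simp
        moreover have "f (u k + v) = w" using module_hom.add[OF hom, of "u k" v] fu fv by simp
        ultimately show ?thesis by blast
      qed
    qed
  qed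
  have "f 0 = 0" by (rule module_hom.zero[OF hom])
  then have "f ` (W - {0}) = gf2_space (r - 1) - {0}"
    using img inj linear_hyperplane_zero[OF W] by (subst inj_on_image_set_diff[of _ W]) auto
  then show ?thesis
    using linear_inj_vector_matroid_iso[OF hom inj linear_hyperplane_subspace[OF W], of "W - {0}"]
    by (auto simp: PG_def)
qed

text \<open>An isomorphism need not be linear a priori, but it preserves dependence of triples, and
  for distinct nonzero vectors this is the relation \<open>z = x + y\<close>.\<close>

lemma vector_matroid_iso_triangles:
  assumes "vector_matroid X \<cong>\<^sub>M vector_matroid Y" and "0 \<notin> X" "0 \<notin> Y"
  obtains \<phi> where "bij_betw \<phi> X Y"
    and "\<And>x y z. x \<in> X \<Longrightarrow> y \<in> X \<Longrightarrow> z \<in> X \<Longrightarrow> x \<noteq> y \<Longrightarrow>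
      z = x + y \<longleftrightarrow> \<phi> z = \<phi> x + \<phi> y"
proof -
  obtain \<phi> where bij: "bij_betw \<phi> X Y"
    and ind: "\<And>S. S \<subseteq> X \<Longrightarrow> gf2.independent S \<longleftrightarrow> gf2.independent (\<phi> ` S)"
    using assms(1) unfolding matroid_iso_def
    by (auto simp: indeps_vector_matroid bij_betw_def) (metis image_mono)
  have sum_ne: "z \<noteq> x \<and> z \<noteq> y" if "x \<noteq> 0" "y \<noteq> 0" "z = x + y" for x y z :: gf2_vec
    using that by auto
  have "z = x + y \<longleftrightarrow> \<phi> z = \<phi> x + \<phi> y" if xyz: "x \<in> X" "y \<in> X" "z \<in> X" "x \<noteq> y" for x y z
  proof -
    have nz: "x \<noteq> 0" "y \<noteq> 0" "z \<noteq> 0" "\<phi> x \<noteq> 0" "\<phi> y \<noteq> 0" "\<phi> z \<noteq> 0"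
      using xyz assms bij_betwE[OF bij] by metis+
    have eq: "\<phi> a = \<phi> b \<longleftrightarrow> a = b" if "a \<in> X" "b \<in> X" for a b
      using bij that by (auto simp: bij_betw_def inj_on_eq_iff)
    show ?thesis
    proof (cases "x = z \<or> y = z")
      \<comment> \<open>Here both sides are false, since neither summand is 0.\<close>
      case True
      then show ?thesis using sum_ne nz by metis
    next
      case False
      then show ?thesis
        using gf2_triple_dependent_iff[of x y z] gf2_triple_dependent_iff[of "\<phi> x" "\<phi> y" "\<phi> z"]
          ind[of "{x, y, z}"] nz xyz eq by simp
    qed
  qed
  then show ?thesis using that bij by blast
qed

text \<open>The points of \<open>PG (r - 1)\<close> form with 0 a subspace, so any two of them lie in a triangle.
  Triangles are carried back by the isomorphism, so \<open>X\<close> with 0 is closed under addition, too.\<close>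

lemma iso_PG_pred_imp_linear_hyperplane:
  assumes r: "r \<ge> 1" and X: "X \<subseteq> ground (PG r)" and iso: "vector_matroid X \<cong>\<^sub>M PG (r - 1)"
  shows "linear_hyperplane r (insert 0 X)"
proof (rule linear_hyperplane_if_card)
  let ?Y = "gf2_space (r - 1) - {0}"
  have X0: "0 \<notin> X" using X by (auto simp: ground_PG)
  obtain \<phi> where bij: "bij_betw \<phi> X ?Y"
    and tri: "\<And>x y z. x \<in> X \<Longrightarrow> y \<in> X \<Longrightarrow> z \<in> X \<Longrightarrow> x \<noteq> y \<Longrightarrow>
      z = x + y \<longleftrightarrow> \<phi> z = \<phi> x + \<phi> y"
    using iso X0 unfolding PG_def by (rule vector_matroid_iso_triangles) auto
  show "insert 0 X \<subseteq> gf2_space r" using X zero_in_gf2_space by (auto simp: ground_PG)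
  have "x + y \<in> X" if xy: "x \<in> X" "y \<in> X" "x \<noteq> y" for x y
  proof -
    have "\<phi> x \<noteq> \<phi> y" using bij xy by (auto simp: bij_betw_def inj_on_eq_iff)
    then have "\<phi> x + \<phi> y \<noteq> 0" by (metis add.right_neutral gf2_add_cancel)
    moreover have "\<phi> x \<in> ?Y" "\<phi> y \<in> ?Y" using bij xy by (auto dest: bij_betwE)
    ultimately have "\<phi> x + \<phi> y \<in> ?Y" by (auto intro: add_in_gf2_space)
    then have "\<phi> x + \<phi> y \<in> \<phi> ` X" using bij_betw_imp_surj_on[OF bij] by (simp only:)
    then obtain z where "z \<in> X" "\<phi> z = \<phi> x + \<phi> y" by (metis imageE)
    then show ?thesis using tri xy by blast
  qed
  then have "x + y \<in> insert 0 X" if "x \<in> insert 0 X" "y \<in> insert 0 X" for x y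
    using that by (cases "x = y") auto
  then show "gf2.subspace (insert 0 X)" unfolding gf2_subspace_iff by blast
  have "finite X" using X by (rule finite_subset_PG)
  \<comment> \<open>Adding 0 on both sides makes \<open>insert 0 X\<close> as large as
    \<open>gf2_space (r - 1)\<close>, which is half of \<open>gf2_space r\<close>.\<close>
  then have "card (insert 0 X) = Suc (card ?Y)"
    using X0 bij_betw_same_card[OF bij] by simp
  also have "\<dots> = card (gf2_space (r - 1))"
    using finite_gf2_space zero_in_gf2_space by (intro card.remove[symmetric]) auto
  finally show "2 * card (insert 0 X) = card (gf2_space r)"
    using linear_hyperplane_card[OF linear_hyperplane_pred[OF r]] by simp
qed

text \<open>An affine geometry has no triangles, hence \<open>X\<close> has none. For \<open>x \<in> X\<close> the translate \<open>x + X\<close>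
  thus misses \<open>X\<close>, and having half the size of the space it is the complement of \<open>X\<close>.\<close>

lemma iso_AG_imp_linear_hyperplane:
  assumes X: "X \<subseteq> ground (PG r)" and A: "is_AG r A" and iso: "vector_matroid X \<cong>\<^sub>M A"
  shows "linear_hyperplane r (gf2_space r - X)"
proof (rule linear_hyperplane_if_card)
  let ?V = "gf2_space r"
  obtain U where U: "linear_hyperplane r U" and AU: "A = vector_matroid (?V - U)"
    using A unfolding is_AG_iff by blast
  have zero: "0 \<notin> ?V - U" using linear_hyperplane_zero[OF U] by blast
  have X0: "0 \<notin> X" and XV: "X \<subseteq> ?V" using X by (auto simp: ground_PG)
  have finX: "finite X" using XV finite_gf2_space by (rule finite_subset)
  obtain \<phi> where bij: "bij_betw \<phi> X (?V - U)"
    and tri: "\<And>x y z. x \<in> X \<Longrightarrow> y \<in> X \<Longrightarrow> z \<in> X \<Longrightarrow> x \<noteq> y \<Longrightarrow>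
      z = x + y \<longleftrightarrow> \<phi> z = \<phi> x + \<phi> y"
    using iso X0 zero unfolding AU by (rule vector_matroid_iso_triangles) auto
  have free: "x + y \<notin> X" if xy: "x \<in> X" "y \<in> X" for x y
  proof (cases "x = y")
    case True
    then show ?thesis using X0 by simp
  next
    case False
    show ?thesis
    proof
      \<comment> \<open>The image would be a triangle outside \<open>U\<close>, but the sum of two
        vectors outside \<open>U\<close> lies in \<open>U\<close>.\<close>
      assume z: "x + y \<in> X"
      then have "\<phi> (x + y) = \<phi> x + \<phi> y" using tri xy False by blast
      moreover have "\<phi> x \<in> ?V - U" "\<phi> y \<in> ?V - U" "\<phi> (x + y) \<in> ?V - U"
        using bij xy z by (auto dest: bij_betwE)
      ultimately show False using linear_hyperplane_add[OF U, of "\<phi> x" "\<phi> y"] by simp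
    qed
  qed
  have cardU: "2 * card U = card ?V" by (rule linear_hyperplane_card[OF U])
  have "finite U" using linear_hyperplane_subset[OF U] finite_gf2_space by (rule finite_subset)
  then have cardX: "card X = card U"
    using bij_betw_same_card[OF bij] cardU linear_hyperplane_subset[OF U]
    by (simp add: card_Diff_subset)
  have cardC: "card (?V - X) = card U"
    using cardX cardU finX XV by (simp add: card_Diff_subset)
  then show "2 * card (?V - X) = card ?V" using cardU by simp
  show "?V - X \<subseteq> ?V" by blast
  have trans: "(+) x ` X = ?V - X" if x: "x \<in> X" for x
  proof (rule card_subset_eq)
    show "finite (?V - X)" using finite_gf2_space by blast
    show "(+) x ` X \<subseteq> ?V - X" using x free XV by (auto intro: add_in_gf2_space)
    show "card ((+) x ` X) = card (?V - X)" using cardX cardC by (simp add: card_image)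
  qed
  obtain x where x: "x \<in> X"
  proof -
    have "U \<noteq> {}" using linear_hyperplane_zero[OF U] by blast
    then have "card X \<noteq> 0" using cardX \<open>finite U\<close> by simp
    then show ?thesis using that by fastforce
  qed
  have "a + b \<in> ?V - X" if ab: "a \<in> ?V - X" "b \<in> ?V - X" for a b
  proof -
    \<comment> \<open>Both vectors are written as translates by the same \<open>x\<close>, which
      cancels in the sum; what remains is a sum of two elements of \<open>X\<close>.\<close>
    obtain a' b' where "a' \<in> X" "a = x + a'" "b' \<in> X" "b = x + b'"
      using ab trans[OF x] by blast
    then have "a + b = a' + b'" by (simp add: ac_simps)
    then show ?thesis using free \<open>a' \<in> X\<close> \<open>b' \<in> X\<close> XV by (auto intro: add_in_gf2_space)
  qed
  then show "gf2.subspace (?V - X)"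
    using X0 zero_in_gf2_space unfolding gf2_subspace_iff by blast
qed

section \<open>The point sets reachable by complementation and switching\<close>

text \<open>The members are, in this order, the point sets of the copies of P_r, U_{0,0}, P_{r-1}
  and A_r inside \<open>PG r\<close>. On point sets both operations are plain symmetric
  differences.\<close>

definition switching_class :: "nat \<Rightarrow> gf2_vec set set" where
  "switching_class r = {gf2_space r - {0}, {}} \<union>
     {W - {0} | W. linear_hyperplane r W} \<union> {gf2_space r - W | W. linear_hyperplane r W}"

lemma switching_class_subset:
  assumes "X \<in> switching_class r"
  shows "X \<subseteq> ground (PG r)"
  using assms linear_hyperplane_subset linear_hyperplane_zero
  unfolding switching_class_def ground_PG by blast

lemma switching_class_complement:
  assumes "X \<in> switching_class r"
  shows "sym_diff X (gf2_space r - {0}) \<in> switching_class r"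
proof -
  have "sym_diff (W - {0}) (gf2_space r - {0}) = gf2_space r - W"
    "sym_diff (gf2_space r - W) (gf2_space r - {0}) = W - {0}" if "linear_hyperplane r W" for W
    using linear_hyperplane_subset[OF that] linear_hyperplane_zero[OF that] by auto
  then show ?thesis
    using assms unfolding switching_class_def by auto
qed

text \<open>In terms of indicator functionals this is the sum of two cocircuits.\<close>

lemma sym_diff_linear_hyperplanes:
  assumes W: "linear_hyperplane r W" and U: "linear_hyperplane r U" and ne: "W \<noteq> U"
  shows "linear_hyperplane r (gf2_space r - sym_diff W U)"
proof -
  have "sym_diff W U \<noteq> {}" using ne by blast
  then have "gf2_space r - sym_diff W U \<subset> gf2_space r"
    using linear_hyperplane_subset[OF W] linear_hyperplane_subset[OF U] by blast
  then show ?thesis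
    using linear_hyperplane_add[OF W] linear_hyperplane_add[OF U]
    unfolding linear_hyperplane_def by (auto simp: add_in_gf2_space)
qed

text \<open>The essential case is that of two cocircuits: equal ones cancel, and distinct ones add
  up to a third. The other cases follow by complementing.\<close>

lemma switching_class_cocircuit:
  assumes X: "X \<in> switching_class r" and U: "linear_hyperplane r U"
  shows "sym_diff X (gf2_space r - U) \<in> switching_class r"
proof -
  let ?V = "gf2_space r"
  have co: "sym_diff (?V - W) (?V - U) \<in> switching_class r" if W: "linear_hyperplane r W" for W
  proof (cases "W = U")
    case True
    then show ?thesis by (simp add: switching_class_def)
  next
    case False
    have "sym_diff (?V - W) (?V - U) = ?V - (?V - sym_diff W U)"
      using linear_hyperplane_subset[OF W] linear_hyperplane_subset[OF U] by blast
    then show ?thesis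
      using sym_diff_linear_hyperplanes[OF W U False] unfolding switching_class_def by blast
  qed
  from X consider "X = ?V - {0}" | "X = {}" | W where "linear_hyperplane r W" "X = W - {0}"
    | W where "linear_hyperplane r W" "X = ?V - W"
    unfolding switching_class_def by blast
  then show ?thesis
  proof cases
    case 1
    then have "sym_diff X (?V - U) = U - {0}"
      using linear_hyperplane_subset[OF U] linear_hyperplane_zero[OF U] by auto
    then show ?thesis using U unfolding switching_class_def by auto
  next
    case 2
    then show ?thesis using U unfolding switching_class_def by auto
  next
    case (3 W)
    \<comment> \<open>\<open>W - {0}\<close> is the cocircuit \<open>?V - W\<close> complemented in
      the ground set, and this complementation may be carried out after the switching.\<close>
    then have "sym_diff X (?V - U) = sym_diff (sym_diff (?V - W) (?V - U)) (?V - {0})"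
      using linear_hyperplane_subset[OF U] linear_hyperplane_zero[OF U]
        linear_hyperplane_subset[OF 3(1)] linear_hyperplane_zero[OF 3(1)] by auto
    then show ?thesis using switching_class_complement[OF co[OF 3(1)]] by simp
  next
    case (4 W)
    then show ?thesis using co by blast
  qed
qed

text \<open>The class contains the full point set and is invariant under both operations.
  Conversely, two steps suffice: complementing gives the empty set, switching the full set gives
  \<open>W - {0}\<close>, and switching the empty set gives \<open>?V - W\<close>.\<close>

lemma obtainable_from_PG_iff:
  "obtainable_from r (PG r) N \<longleftrightarrow> (\<exists>X\<in>switching_class r. N = vector_matroid X)"
proof
  assume "obtainable_from r (PG r) N"
  then have "(cs_step r)\<^sup>*\<^sup>* (PG r) N" by (simp add: obtainable_from_def)
  then show "\<exists>X\<in>switching_class r. N = vector_matroid X"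
  proof (induction rule: rtranclp_induct)
    case base
    show ?case by (auto simp: PG_def switching_class_def)
  next
    case (step M N)
    then obtain X where X: "X \<in> switching_class r" "M = vector_matroid X" by blast
    note XE = switching_class_subset[OF X(1)]
    from step(2) show ?case
    proof cases
      case complement
      then have "N = vector_matroid (sym_diff X (ground (PG r)))"
        using X(2) msym_diff_PG[OF XE subset_refl] by (simp add: complementation_def)
      then show ?thesis using switching_class_complement[OF X(1)] by (auto simp: ground_PG)
    next
      case (switch C)
      then obtain U where U: "linear_hyperplane r U" "C = gf2_space r - U"
        unfolding cocircuit_PG_iff by blast
      then have "C \<subseteq> ground (PG r)" using linear_hyperplane_zero[OF U(1)] by (auto simp: ground_PG)
      then have "N = vector_matroid (sym_diff X C)"
        using X(2) switch msym_diff_PG[OF XE] by (simp add: switching_def)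
      then show ?thesis using switching_class_cocircuit[OF X(1) U(1)] U(2) by blast
    qed
  qed
next
  let ?V = "gf2_space r"
  have comp: "cs_step r (vector_matroid X) (vector_matroid (sym_diff X (?V - {0})))"
    if "X \<subseteq> ground (PG r)" for X
    using cs_step.complement[of r "vector_matroid X"] msym_diff_PG[OF that subset_refl]
    by (simp add: complementation_def ground_PG)
  have switch: "cs_step r (vector_matroid X) (vector_matroid (sym_diff X (?V - W)))"
    if "X \<subseteq> ground (PG r)" "linear_hyperplane r W" for X W
  proof -
    have "?V - W \<subseteq> ground (PG r)"
      using linear_hyperplane_zero[OF that(2)] by (auto simp: ground_PG)
    moreover have "cocircuit (PG r) (?V - W)" using that cocircuit_PG_iff by blast
    ultimately show ?thesis
      using cs_step.switch[of r "?V - W" "vector_matroid X"] msym_diff_PG[OF that(1)]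
      by (simp add: switching_def)
  qed
  have empty: "(cs_step r)\<^sup>*\<^sup>* (PG r) (vector_matroid {})"
    using comp[of "?V - {0}"] by (auto simp: PG_def)
  assume "\<exists>X\<in>switching_class r. N = vector_matroid X"
  then consider "N = PG r" | "N = vector_matroid {}"
    | W where "linear_hyperplane r W" "N = vector_matroid (W - {0})"
    | W where "linear_hyperplane r W" "N = vector_matroid (?V - W)"
    unfolding switching_class_def by (auto simp: PG_def)
  then show "obtainable_from r (PG r) N" unfolding obtainable_from_def
  proof cases
    case (3 W)
    have "sym_diff (?V - {0}) (?V - W) = W - {0}"
      using linear_hyperplane_subset[OF 3(1)] linear_hyperplane_zero[OF 3(1)] by auto
    then show "(cs_step r)\<^sup>*\<^sup>* (PG r) N"
      using switch[of "?V - {0}" W] 3 by (auto simp: PG_def)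
  next
    case (4 W)
    then have "cs_step r (vector_matroid {}) N" using switch[of "{}" W] by simp
    with empty show "(cs_step r)\<^sup>*\<^sup>* (PG r) N" by (rule rtranclp.rtrancl_into_rtrancl)
  qed (use empty in auto)
qed

section \<open>From point sets to isomorphism types\<close>

lemma matroid_iso_refl: "M \<cong>\<^sub>M M"
  unfolding matroid_iso_def by (intro exI[of _ id]) auto

lemma vector_matroid_iso_uniform_0_iff: "vector_matroid X \<cong>\<^sub>M uniform 0 0 \<longleftrightarrow> X = {}"
proof
  assume "vector_matroid X \<cong>\<^sub>M uniform 0 0"
  then show "X = {}" by (auto simp: matroid_iso_def uniform_def bij_betw_def)
next
  assume "X = {}"
  then show "vector_matroid X \<cong>\<^sub>M uniform 0 0"
    by (auto simp: matroid_iso_def uniform_def bij_betw_def indeps_vector_matroid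
      gf2.independent_empty)
qed

text \<open>Counting points is enough, as \<open>X\<close> lies in the finite ground set.\<close>

lemma restriction_iso_PG_iff:
  assumes "X \<subseteq> ground (PG r)"
  shows "vector_matroid X \<cong>\<^sub>M PG r \<longleftrightarrow> X = ground (PG r)"
proof
  assume "vector_matroid X \<cong>\<^sub>M PG r"
  then have "card X = card (ground (PG r))"
    by (auto simp: matroid_iso_def intro: bij_betw_same_card)
  then show "X = ground (PG r)"
    using assms finite_gf2_space by (intro card_subset_eq) (auto simp: ground_PG)
next
  assume "X = ground (PG r)"
  then show "vector_matroid X \<cong>\<^sub>M PG r" by (simp add: PG_def matroid_iso_refl)
qed

theorem proposition3p4:
  fixes r :: nat and N :: "gf2_vec matroid"
  assumes "r \<ge> 1" and "N \<in> restrictions_PG r"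
  shows "obtainable_from r (PG r) N \<longleftrightarrow>
    N \<cong>\<^sub>M PG r \<or> N \<cong>\<^sub>M uniform 0 0 \<or> N \<cong>\<^sub>M PG (r - 1) \<or> (\<exists>A. is_AG r A \<and> N \<cong>\<^sub>M A)"
proof -
  let ?V = "gf2_space r"
  obtain X where X: "X \<subseteq> ground (PG r)" and N: "N = vector_matroid X"
    using assms(2) mrestrict_PG unfolding restrictions_PG_def by auto
  \<comment> \<open>A vector matroid determines its point set as its ground set, so \<open>X\<close>
    itself must be the member of the class.\<close>
  have "obtainable_from r (PG r) N \<longleftrightarrow> X \<in> switching_class r"
    unfolding obtainable_from_PG_iff N by (metis ground_vector_matroid)
  also have "\<dots> \<longleftrightarrow> X = ground (PG r) \<or> X = {} \<or> (\<exists>W. linear_hyperplane r W \<and> X = W - {0})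
      \<or> (\<exists>W. linear_hyperplane r W \<and> X = ?V - W)"
    by (auto simp: switching_class_def ground_PG)
  \<comment> \<open>The witness \<open>W\<close> is recovered from \<open>X\<close> alone, here as
    \<open>insert 0 X\<close> and for affine geometries as \<open>?V - X\<close>.\<close>
  also have "(\<exists>W. linear_hyperplane r W \<and> X = W - {0}) \<longleftrightarrow> N \<cong>\<^sub>M PG (r - 1)"
  proof
    assume "N \<cong>\<^sub>M PG (r - 1)"
    then have "linear_hyperplane r (insert 0 X)"
      using iso_PG_pred_imp_linear_hyperplane[OF assms(1) X] N by simp
    moreover have "X = insert 0 X - {0}" using X by (auto simp: ground_PG)
    ultimately show "\<exists>W. linear_hyperplane r W \<and> X = W - {0}" by blast
  qed (use linear_hyperplane_iso_PG N in blast)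
  also have "(\<exists>W. linear_hyperplane r W \<and> X = ?V - W) \<longleftrightarrow> (\<exists>A. is_AG r A \<and> N \<cong>\<^sub>M A)"
  proof
    assume "\<exists>A. is_AG r A \<and> N \<cong>\<^sub>M A"
    then have "linear_hyperplane r (?V - X)"
      using iso_AG_imp_linear_hyperplane[OF X] N by blast
    moreover have "X = ?V - (?V - X)" using X by (auto simp: ground_PG)
    ultimately show "\<exists>W. linear_hyperplane r W \<and> X = ?V - W" by blast
  next
    assume "\<exists>W. linear_hyperplane r W \<and> X = ?V - W"
    then show "\<exists>A. is_AG r A \<and> N \<cong>\<^sub>M A" using N matroid_iso_refl unfolding is_AG_iff by blast
  qed
  finally show ?thesis
    using restriction_iso_PG_iff[OF X] vector_matroid_iso_uniform_0_iff N by simp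
qed

end
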